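(* Let $H=(V(H),E(H))$ be a finite multigraph with no isolated vertex and minimum degree $d_{\min}(H)\ge2$, and let $\varphi:V(H)\to[0,1]$ be an optimal solution of the linear program $$\text{maximize }\sum_{v\in V(H)}\phi(v)\ \text{ over } \phi:V(H)\to[0,1]\ \text{ subject to } \phi(x)+\phi(y)\le1\text{ for all }(x,y)\in E(H),$$ whose optimal value is denoted $\gamma(H)$. Then $\gamma(H)\le\frac12|E(H)|$. Moreover, if there exists $v\in V(H)$ such that $\varphi(v)\neq0$ and $d(v)\ge3$, then $\gamma(H)<\frac12|E(H)|$.
   Context: A multigraph may have multiple edges but no self-loops. $|E(H)|$ counts edges with multiplicity, and $d(v)$ is the degree of $v$ counted with multiplicity. *)

theory Defs
  imports Complex_Main "HOL-Library.Multiset" "HOL-Library.Extended_Nat" "HOL-Library.FuncSet"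
begin

text \<open>A finite multigraph is a finite vertex set \<open>V\<close> together with a multiset \<open>E\<close> of
  two-element subsets of \<open>V\<close>. Parallel edges are expressed by multiplicities, and a
  self-loop \<open>{x, x}\<close> is ruled out because it has cardinality 1.\<close>

locale finite_multigraph =
  fixes V :: "'v set" and E :: "'v set multiset"
  assumes finite_verts: "finite V"
    and edge_subset: "e \<in># E \<Longrightarrow> e \<subseteq> V"
    and edge_card: "e \<in># E \<Longrightarrow> card e = 2"

definition degree :: "'v set multiset \<Rightarrow> 'v \<Rightarrow> nat" where
  "degree E v = size {#e \<in># E. v \<in> e#}"

definition isolated :: "'v set multiset \<Rightarrow> 'v \<Rightarrow> bool" where
  "isolated E v \<longleftrightarrow> (\<forall>e \<in># E. v \<notin> e)"

text \<open>The minimum is taken in \<^typ>\<open>enat\<close> so that it is meaningful (namely infinite) also for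
  the graph without vertices.\<close>

definition min_degree :: "'v set \<Rightarrow> 'v set multiset \<Rightarrow> enat" where
  "min_degree V E = (INF v\<in>V. enat (degree E v))"

text \<open>Values of \<open>\<phi>\<close> outside \<open>V\<close> are unconstrained and irrelevant.\<close>

definition lp_feasible :: "'v set \<Rightarrow> 'v set multiset \<Rightarrow> ('v \<Rightarrow> real) \<Rightarrow> bool" where
  "lp_feasible V E \<phi> \<longleftrightarrow> \<phi> \<in> V \<rightarrow> {0..1} \<and> (\<forall>x y. {x, y} \<in># E \<longrightarrow> \<phi> x + \<phi> y \<le> 1)"

definition lp_optimal :: "'v set \<Rightarrow> 'v set multiset \<Rightarrow> ('v \<Rightarrow> real) \<Rightarrow> bool" where
  "lp_optimal V E \<phi> \<longleftrightarrow> is_arg_max (\<lambda>\<psi>. \<Sum>v\<in>V. \<psi> v) (lp_feasible V E) \<phi>"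

definition lp_value :: "'v set \<Rightarrow> 'v set multiset \<Rightarrow> real" where
  "lp_value V E = (SUP \<psi>\<in>Collect (lp_feasible V E). \<Sum>v\<in>V. \<psi> v)"

lemma lp_value_eq_optimal:
  assumes "lp_optimal V E \<phi>"
  shows "lp_value V E = (\<Sum>v\<in>V. \<phi> v)"
  unfolding lp_value_def
proof (rule cSup_eq_maximum)
  show "(\<Sum>v\<in>V. \<phi> v) \<in> (\<lambda>\<psi>. \<Sum>v\<in>V. \<psi> v) ` Collect (lp_feasible V E)"
    using assms by (auto simp: lp_optimal_def is_arg_max_def)
next
  fix s assume "s \<in> (\<lambda>\<psi>. \<Sum>v\<in>V. \<psi> v) ` Collect (lp_feasible V E)"
  then show "s \<le> (\<Sum>v\<in>V. \<phi> v)"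
    using assms by (auto simp: lp_optimal_def is_arg_max_def not_less)
qed

end

theory Submission
  imports Defs
begin

text \<open>
  The argument is a double count of \<open>\<phi>\<close> over the edges. Adding the constraints
  \<open>\<phi> x + \<phi> y \<le> 1\<close> over all edges, with multiplicity, bounds the degree-weighted total
  \<open>\<Sum>v\<in>V. d(v) * \<phi> v\<close> by the number of edges, since each vertex occurs in exactly \<open>d(v)\<close> of
  the constraints. This is the handshake identity (\<open>weighted_handshake\<close>) combined with the
  constraints (\<open>degree_weighted_sum_le\<close>).

  As every degree is at least 2 and \<open>\<phi> \<ge> 0\<close>, the degree-weighted total is at least twice the
  objective, which gives the bound for every feasible \<open>\<phi>\<close>. A vertex with \<open>\<phi> v > 0\<close> and
  \<open>d(v) \<ge> 3\<close> makes this last comparison strict. For an optimal \<open>\<phi>\<close> the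
  objective is the value of the linear program.
\<close>

text \<open>
  Inserting an edge \<open>e\<close> raises the degree of exactly the vertices of \<open>e\<close> by one. The usual
  handshake lemma is the case of constant \<open>f\<close> and edges of size two; the weights are what
  lets it be compared with the edge constraints.
\<close>
lemma weighted_handshake:
  fixes f :: "'v \<Rightarrow> real"
  assumes "finite V" and "\<And>e. e \<in># E \<Longrightarrow> e \<subseteq> V"
  shows "(\<Sum>v\<in>V. real (degree E v) * f v) = (\<Sum>e\<in>#E. \<Sum>v\<in>e. f v)"
  using assms(2)
proof (induction E)
  case empty
  then show ?case by (simp add: degree_def)
next
  case (add e E)
  have "(\<Sum>v\<in>V. real (degree (add_mset e E) v) * f v)
      = (\<Sum>v\<in>V. (if v \<in> e then f v else 0) + real (degree E v) * f v)"
    by (rule sum.cong) (auto simp: degree_def algebra_simps)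
  also have "\<dots> = (\<Sum>v\<in>V \<inter> e. f v) + (\<Sum>v\<in>V. real (degree E v) * f v)"
    using assms(1) by (simp add: sum.distrib sum.inter_restrict)
  also have "V \<inter> e = e"
    using add.prems by auto
  finally show ?case
    using add by simp
qed

lemma (in finite_multigraph) degree_weighted_sum_le:
  assumes "lp_feasible V E \<phi>"
  shows "(\<Sum>v\<in>V. real (degree E v) * \<phi> v) \<le> real (size E)"
proof -
  have "(\<Sum>v\<in>e. \<phi> v) \<le> 1" if "e \<in># E" for e
  proof -
    obtain x y where "e = {x, y}" "x \<noteq> y"
      using edge_card[OF \<open>e \<in># E\<close>] by (auto simp: card_2_iff)
    then show ?thesis
      using assms \<open>e \<in># E\<close> by (auto simp: lp_feasible_def)
  qed
  then have "(\<Sum>e\<in>#E. \<Sum>v\<in>e. \<phi> v) \<le> (\<Sum>e\<in>#E. 1)"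
    by (intro sum_mset_mono) auto
  then show ?thesis
    using weighted_handshake[OF finite_verts edge_subset] by simp
qed

lemma min_degree_le_degree:
  assumes "v \<in> V"
  shows "min_degree V E \<le> enat (degree E v)"
  unfolding min_degree_def using assms by (rule INF_lower)

theorem lemma4p1:
  fixes V :: "'v set" and E :: "'v set multiset" and \<phi> :: "'v \<Rightarrow> real"
  assumes "finite_multigraph V E"
    and "\<forall>v\<in>V. \<not> isolated E v"
    and "min_degree V E \<ge> 2"
    and "lp_optimal V E \<phi>"
  shows "lp_value V E \<le> 1 / 2 * real (size E) \<and>
    ((\<exists>v\<in>V. \<phi> v \<noteq> 0 \<and> degree E v \<ge> 3) \<longrightarrow> lp_value V E < 1 / 2 * real (size E))"
proof -
  interpret finite_multigraph V E by fact
  have feasible: "lp_feasible V E \<phi>"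
    using assms(4) by (simp add: lp_optimal_def is_arg_max_def)
  then have nonneg: "\<phi> v \<ge> 0" if "v \<in> V" for v
    using that by (auto simp: lp_feasible_def Pi_iff)
  have degree_ge_2: "degree E v \<ge> 2" if "v \<in> V" for v
    using order_trans[OF assms(3) min_degree_le_degree[OF that]]
    by (simp add: numeral_eq_enat)
  have pointwise: "2 * \<phi> v \<le> real (degree E v) * \<phi> v" if "v \<in> V" for v
    using degree_ge_2[OF that] nonneg[OF that] by (intro mult_right_mono) auto
  have lp_value_doubled: "2 * lp_value V E = (\<Sum>v\<in>V. 2 * \<phi> v)"
    by (simp add: lp_value_eq_optimal[OF assms(4)] sum_distrib_left)
  note upper = degree_weighted_sum_le[OF feasible]
  have "(\<Sum>v\<in>V. 2 * \<phi> v) \<le> (\<Sum>v\<in>V. real (degree E v) * \<phi> v)"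
    using pointwise by (rule sum_mono)
  then have "lp_value V E \<le> 1 / 2 * real (size E)"
    using lp_value_doubled upper by simp
  moreover have "lp_value V E < 1 / 2 * real (size E)"
    if "v \<in> V" "\<phi> v \<noteq> 0" "degree E v \<ge> 3" for v
  proof -
    have "2 * \<phi> v < real (degree E v) * \<phi> v"
      using that nonneg[OF \<open>v \<in> V\<close>] by (intro mult_strict_right_mono) auto
    then have "(\<Sum>v\<in>V. 2 * \<phi> v) < (\<Sum>v\<in>V. real (degree E v) * \<phi> v)"
      using finite_verts pointwise \<open>v \<in> V\<close> by (intro sum_strict_mono_ex1) auto
    then show ?thesis
      using lp_value_doubled upper by simp
  qed
  ultimately show ?thesis
    by blast
qed

end
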